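(* There exists an absolute positive constant $K$ such that for every integer $k \ge 2$, every integer $n \ge 1$, every integer $m \ge 1$ and every $p \in \Delta^{k-1}$, $$\|Z_{n,k,p}\|_m \le K (k + m).$$
   Context: All logarithms are natural. For a random variable $X$ and a positive integer $m$, $\|X\|_m = (\mathbb{E}|X|^m)^{1/m}$. For an integer $k \ge 2$, $\Delta^{k-1} = \{p = (p_1,\dots,p_k) : p_i \ge 0, \sum_{i=1}^k p_i = 1\}$ is the probability simplex. For $n \ge 1$ let $(X_1,\dots,X_k) \sim \mathrm{Multinomial}(n,p)$ and $\widehat{p}_{n,k} = (\widehat p_1,\dots,\widehat p_k) = (X_1/n,\dots,X_k/n)$. The relative entropy is $D(\widehat{p}_{n,k}\|p) = \sum_{i=1}^k \widehat p_i \log(\widehat p_i/p_i)$, with terms having $\widehat p_i = 0$ equal to $0$ (this covers $p_i = 0$, in which case $\widehat p_i = 0$ almost surely), and $Z_{n,k,p} := 2n D(\widehat{p}_{n,k}\|p)$. *)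

theory Defs
  imports "HOL-Probability.Probability" "HOL-Combinatorics.Multiset_Permutations"
begin

text \<open>
  Vectors with \<open>k\<close> entries are functions \<open>nat \<Rightarrow> real\<close> read on the index set \<open>{1..k}\<close>;
  their values elsewhere are irrelevant.
\<close>

definition prob_simplex :: "nat \<Rightarrow> (nat \<Rightarrow> real) set" where
  "prob_simplex k = {p. (\<forall>i\<in>{1..k}. 0 \<le> p i) \<and> (\<Sum>i=1..k. p i) = 1}"

definition categorical_pmf :: "nat \<Rightarrow> (nat \<Rightarrow> real) \<Rightarrow> nat pmf" where
  "categorical_pmf k p = embed_pmf (\<lambda>i. if i \<in> {1..k} then p i else 0)"

text \<open>
  \<open>Multinomial(n, p)\<close> is the law of the counts \<open>(X\<^sub>1, \<dots>, X\<^sub>k)\<close> of the categories among \<open>n\<close>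
  independent draws from \<open>p\<close>.
\<close>

definition multinomial_pmf :: "nat \<Rightarrow> nat \<Rightarrow> (nat \<Rightarrow> real) \<Rightarrow> (nat \<Rightarrow> nat) pmf" where
  "multinomial_pmf n k p = map_pmf count_list (replicate_pmf n (categorical_pmf k p))"

definition empirical :: "nat \<Rightarrow> (nat \<Rightarrow> nat) \<Rightarrow> nat \<Rightarrow> real" where
  "empirical n x i = real (x i) / real n"

text \<open>
  Terms with \<open>q i = 0\<close> vanish because of the factor \<open>q i\<close>. If \<open>q i > 0 = p i\<close> for some \<open>i\<close>, the
  relative entropy would be infinite and the value below is meaningless; for an empirical
  distribution of draws from \<open>p\<close> this has probability \<open>0\<close>.
\<close>

definition rel_entropy :: "nat \<Rightarrow> (nat \<Rightarrow> real) \<Rightarrow> (nat \<Rightarrow> real) \<Rightarrow> real" where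
  "rel_entropy k q p = (\<Sum>i=1..k. q i * ln (q i / p i))"

definition Z_stat :: "nat \<Rightarrow> nat \<Rightarrow> (nat \<Rightarrow> real) \<Rightarrow> (nat \<Rightarrow> nat) \<Rightarrow> real" where
  "Z_stat n k p x = 2 * real n * rel_entropy k (empirical n x) p"

definition moment_norm :: "'a measure \<Rightarrow> nat \<Rightarrow> ('a \<Rightarrow> real) \<Rightarrow> real" where
  "moment_norm M m X = root m (\<integral>\<omega>. \<bar>X \<omega>\<bar> ^ m \<partial>M)"

lemma pmf_categorical_pmf:
  assumes "p \<in> prob_simplex k"
  shows "pmf (categorical_pmf k p) i = (if i \<in> {1..k} then p i else 0)"
proof -
  let ?f = "\<lambda>i. if i \<in> {1..k} then p i else 0"
  have nn: "0 \<le> ?f i" for i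
    using assms by (auto simp: prob_simplex_def)
  have "(\<integral>\<^sup>+ i. ennreal (?f i) \<partial>count_space UNIV) = (\<Sum>i=1..k. ennreal (?f i))"
    by (rule nn_integral_count_space') auto
  also have "\<dots> = ennreal (\<Sum>i=1..k. ?f i)"
    using nn by (intro sum_ennreal)
  also have "(\<Sum>i=1..k. ?f i) = 1"
    using assms by (simp add: prob_simplex_def)
  finally have "(\<integral>\<^sup>+ i. ennreal (?f i) \<partial>count_space UNIV) = 1" by simp
  then show ?thesis
    unfolding categorical_pmf_def using nn by (subst pmf_embed_pmf) auto
qed

lemma pmf_replicate_pmf:
  "pmf (replicate_pmf n q) xs = (if length xs = n then (\<Prod>y\<leftarrow>xs. pmf q y) else 0)"
proof (induction n arbitrary: xs)
  case 0
  then show ?case by (auto simp: pmf_return)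
next
  case (Suc n)
  have eq: "replicate_pmf (Suc n) q = map_pmf (\<lambda>(x, ys). x # ys) (pair_pmf q (replicate_pmf n q))"
    by (simp add: pair_pmf_def map_bind_pmf)
  show ?case
  proof (cases xs)
    case Nil
    then show ?thesis
      by (auto simp: pmf_eq_0_set_pmf set_replicate_pmf simp del: replicate_pmf.simps)
  next
    case (Cons a as)
    have "pmf (replicate_pmf (Suc n) q) xs = pmf (pair_pmf q (replicate_pmf n q)) (a, as)"
      unfolding eq Cons
      using pmf_map_inj'[of "\<lambda>(x, ys). x # ys" "pair_pmf q (replicate_pmf n q)" "(a, as)"]
      by (auto simp: inj_on_def)
    then show ?thesis
      using Suc.IH[of as] Cons by (simp add: pmf_pair)
  qed
qed

lemma pmf_multinomial_pmf:
  assumes p: "p \<in> prob_simplex k"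
    and sum: "(\<Sum>i=1..k. x i) = n" and zero: "\<And>i. i \<notin> {1..k} \<Longrightarrow> x i = 0"
  shows "pmf (multinomial_pmf n k p) x =
    fact n / (\<Prod>i=1..k. fact (x i)) * (\<Prod>i=1..k. p i ^ x i)"
proof -
  define A where "A = Abs_multiset x"
  have "{i. 0 < x i} \<subseteq> {1..k}"
    using zero by (metis (mono_tags) less_irrefl mem_Collect_eq subsetI)
  then have fin: "finite {i. 0 < x i}"
    by (rule finite_subset) simp
  have countA: "count A = x"
    unfolding A_def by (rule Abs_multiset_inverse) (use fin in simp)
  have setA: "set_mset A \<subseteq> {1..k}"
    using \<open>{i. 0 < x i} \<subseteq> {1..k}\<close> by (auto simp: set_mset_def countA)
  have sizeA: "size A = n"
  proof -
    have "size A = (\<Sum>i\<in>set_mset A. x i)"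
      by (simp add: size_multiset_overloaded_eq countA)
    also have "\<dots> = (\<Sum>i=1..k. x i)"
      using setA by (intro sum.mono_neutral_left) (auto simp: set_mset_def countA)
    finally show ?thesis using sum by simp
  qed
  have pre: "count_list -` {x} = permutations_of_multiset A"
    by (auto simp: permutations_of_multiset_def multiset_eq_iff countA count_mset fun_eq_iff)
  have finP: "finite (permutations_of_multiset A)" by simp
  have prod_eq: "(\<Prod>y\<leftarrow>xs. pmf (categorical_pmf k p) y) = (\<Prod>i=1..k. p i ^ x i)"
    if "xs \<in> permutations_of_multiset A" for xs
  proof -
    have xs: "mset xs = A" using that by (simp add: permutations_of_multiset_def)
    have "(\<Prod>y\<leftarrow>xs. pmf (categorical_pmf k p) y) = (\<Prod>y\<in>#A. pmf (categorical_pmf k p) y)"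
      unfolding xs[symmetric] by (simp flip: prod_mset_prod_list)
    also have "\<dots> = (\<Prod>i\<in>set_mset A. pmf (categorical_pmf k p) i ^ x i)"
      by (simp add: image_prod_mset_multiplicity countA)
    also have "\<dots> = (\<Prod>i=1..k. p i ^ x i)"
      by (rule prod.mono_neutral_cong_left)
         (use setA in \<open>auto simp: pmf_categorical_pmf[OF p] set_mset_def countA\<close>)
    finally show ?thesis .
  qed
  have "pmf (multinomial_pmf n k p) x =
      measure (measure_pmf (replicate_pmf n (categorical_pmf k p))) (permutations_of_multiset A)"
    by (simp add: multinomial_pmf_def pmf_map pre)
  also have "\<dots> = (\<Sum>xs\<in>permutations_of_multiset A. pmf (replicate_pmf n (categorical_pmf k p)) xs)"
    by (rule measure_measure_pmf_finite[OF finP])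
  also have "\<dots> = (\<Sum>xs\<in>permutations_of_multiset A. (\<Prod>i=1..k. p i ^ x i))"
  proof (rule sum.cong)
    fix xs assume xs: "xs \<in> permutations_of_multiset A"
    then have "length xs = n"
      by (simp add: length_finite_permutations_of_multiset sizeA)
    then show "pmf (replicate_pmf n (categorical_pmf k p)) xs = (\<Prod>i=1..k. p i ^ x i)"
      by (simp add: pmf_replicate_pmf prod_eq[OF xs])
  qed simp
  also have "\<dots> = real (card (permutations_of_multiset A)) * (\<Prod>i=1..k. p i ^ x i)"
    by simp
  also have "real (card (permutations_of_multiset A)) = fact n / (\<Prod>i=1..k. fact (x i))"
  proof -
    have "(\<Prod>i\<in>set_mset A. fact (x i)) = (\<Prod>i=1..k. fact (x i) :: nat)"
      using setA by (intro prod.mono_neutral_left) (auto simp: set_mset_def countA)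
    then have "card (permutations_of_multiset A) * (\<Prod>i=1..k. fact (x i)) = fact n"
      using card_permutations_of_multiset_aux[of A] by (simp add: countA sizeA)
    then have "real (card (permutations_of_multiset A) * (\<Prod>i=1..k. fact (x i))) = real (fact n)"
      by (rule arg_cong)
    then have "real (card (permutations_of_multiset A)) * (\<Prod>i=1..k. fact (x i)) = fact n"
      by (simp only: of_nat_mult of_nat_prod of_nat_fact)
    moreover have "(\<Prod>i=1..k. fact (x i)) \<noteq> (0 :: real)"
      by simp
    ultimately show ?thesis by (metis nonzero_eq_divide_eq)
  qed
  finally show ?thesis .
qed

text \<open>The support is finite, so every expectation below is that of an integrable variable.\<close>

lemma finite_set_multinomial_pmf:
  assumes "p \<in> prob_simplex k"
  shows "finite (set_pmf (multinomial_pmf n k p))"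
proof -
  have "set_pmf (categorical_pmf k p) \<subseteq> {1..k}"
    by (auto simp: set_pmf_eq pmf_categorical_pmf[OF assms] split: if_splits)
  then have "set_pmf (replicate_pmf n (categorical_pmf k p)) \<subseteq> {xs. set xs \<subseteq> {1..k} \<and> length xs = n}"
    by (auto simp: set_replicate_pmf)
  then have "finite (set_pmf (replicate_pmf n (categorical_pmf k p)))"
    by (rule finite_subset) (simp add: finite_lists_length_eq)
  then show ?thesis by (simp add: multinomial_pmf_def)
qed

end

theory Submission
  imports Defs
begin

text \<open>
  The statement follows from the exponential moment bound \<open>E exp (Z / 4) \<le> 4 ^ k\<close>, valid for all
  \<open>n \<ge> 1\<close> and \<open>p\<close>: on the event \<open>Z / 4 \<le> 2 k\<close> the variable is already of the right size, and above that
  level the bound gives exponential tails, because \<open>4 ^ k \<le> exp (2 k)\<close>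
  (lemma \<open>power_le_exp_excess\<close>).

  Since \<open>Z / 4 = n D / 2\<close>, weighting the multinomial probability of a count vector \<open>x\<close> by
  \<open>exp (Z / 4)\<close> replaces half of each factor \<open>p i ^ x i\<close> by \<open>(x i / n) ^ x i\<close>. What remains is a
  product over the coordinates of the weights \<open>w p x = sqrt (p x) ^ x / x!\<close>, up to a factor that
  depends on \<open>n\<close> only and equals \<open>1 / w 1 n\<close>. The exponential moment is therefore
  a \<open>k\<close>-fold convolution of such weights, and everything reduces to the two-term inequality
  \<open>\<Sum>j\<le>n. w a j * w b (n - j) \<le> 4 * w (a + b) n\<close> (lemma \<open>half_weight_convolution\<close>).

  For \<open>a + b = 1\<close> this says that the exponential moment is at most \<open>4\<close> for a binomial variable \<open>X\<close>.
  Chernoff's inequality bounds \<open>exp (n D)\<close> at \<open>j\<close> by \<open>1 / P (X \<ge> j)\<close> when \<open>j\<close> lies above the mean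
  (lemma \<open>binomial_tail_le\<close>). The part of the moment above the mean is thus
  at most \<open>\<Sum>j. P (X = j) / sqrt (P (X \<ge> j))\<close>, a lower Riemann sum of the integral of \<open>1 / sqrt u\<close>
  over \<open>[0, 1]\<close>, hence at most \<open>2\<close>. The part below the mean is the same with the roles of \<open>a\<close> and \<open>b\<close>
  exchanged.
\<close>

section \<open>Half-tilted weights and their convolution\<close>

text \<open>
  The geometric mean of the Poisson weights \<open>a ^ j / j!\<close> and \<open>j ^ j / j!\<close>, where the second has its
  mean at \<open>j\<close> itself. The value at \<open>j = 0\<close> is \<open>1\<close>, also for \<open>a = 0\<close>, as it must be for categories of
  probability \<open>0\<close>.
\<close>

definition half_weight :: "real \<Rightarrow> nat \<Rightarrow> real" where
  "half_weight a j = sqrt (a * real j) ^ j / fact j"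

lemma half_weight_nonneg: "0 \<le> a \<Longrightarrow> 0 \<le> half_weight a j"
  by (simp add: half_weight_def)

definition binomial_tail :: "real \<Rightarrow> real \<Rightarrow> nat \<Rightarrow> nat \<Rightarrow> real" where
  "binomial_tail a b n j = (\<Sum>i=j..n. real (n choose i) * a ^ i * b ^ (n - i))"

lemma binomial_tail_nonneg: "0 \<le> a \<Longrightarrow> 0 \<le> b \<Longrightarrow> 0 \<le> binomial_tail a b n j"
  unfolding binomial_tail_def by (intro sum_nonneg) simp

lemma binomial_tail_Suc:
  assumes "j \<le> n"
  shows "binomial_tail a b n j =
    real (n choose j) * a ^ j * b ^ (n - j) + binomial_tail a b n (Suc j)"
  unfolding binomial_tail_def using assms by (simp add: sum.atLeast_Suc_atMost)

lemma binomial_tail_0: "binomial_tail a b n 0 = (a + b) ^ n"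
  unfolding binomial_tail_def by (simp add: binomial_ring atMost_atLeast0)

text \<open>
  Chernoff's inequality for the binomial distribution, cleared of denominators: the exponential tilt
  that moves the mean to \<open>j\<close> turns the weights \<open>a\<close> and \<open>b\<close> into \<open>j\<close> and \<open>n - j\<close>. The assumption
  says that \<open>j\<close> is not below the mean, so that tilting favours the terms with \<open>i \<ge> j\<close>.
\<close>

lemma binomial_tail_le:
  fixes a b :: real
  assumes "0 \<le> a" "0 \<le> b" "j \<le> n" and above: "a * real (n - j) \<le> b * real j"
  shows "binomial_tail a b n j * (real j ^ j * real (n - j) ^ (n - j)) \<le>
    a ^ j * b ^ (n - j) * real n ^ n"
proof -
  let ?J = "real j" and ?L = "real (n - j)"
  have "binomial_tail a b n j * (?J ^ j * ?L ^ (n - j)) =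
      (\<Sum>i=j..n. real (n choose i) * (a ^ i * b ^ (n - i) * (?J ^ j * ?L ^ (n - j))))"
    unfolding binomial_tail_def by (simp add: sum_distrib_right mult.assoc)
  also have "\<dots> \<le> (\<Sum>i=j..n. real (n choose i) * (a ^ j * b ^ (n - j) * (?J ^ i * ?L ^ (n - i))))"
  proof (intro sum_mono mult_left_mono)
    fix i assume i: "i \<in> {j..n}"
    define d where "d = i - j"
    have eqs: "i = j + d" "n - j = (n - i) + d"
      using i by (auto simp: d_def)
    \<comment> \<open>The two sides agree up to the factors \<open>(a * L) ^ d\<close> and \<open>(b * J) ^ d\<close>.\<close>
    have "(a * ?L) ^ d \<le> (b * ?J) ^ d"
      using above \<open>0 \<le> a\<close> by (intro power_mono) auto
    then have "(a ^ j * b ^ (n - i) * (?J ^ j * ?L ^ (n - i))) * (a * ?L) ^ d \<le>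
        (a ^ j * b ^ (n - i) * (?J ^ j * ?L ^ (n - i))) * (b * ?J) ^ d"
      using assms by (intro mult_left_mono) auto
    moreover have "a ^ i * b ^ (n - i) * (?J ^ j * ?L ^ (n - j)) =
        (a ^ j * b ^ (n - i) * (?J ^ j * ?L ^ (n - i))) * (a * ?L) ^ d"
    proof -
      have "?L ^ (n - j) = ?L ^ (n - i) * ?L ^ d" by (metis eqs(2) power_add)
      then show ?thesis by (simp add: eqs(1) power_add power_mult_distrib)
    qed
    moreover have "a ^ j * b ^ (n - j) * (?J ^ i * ?L ^ (n - i)) =
        (a ^ j * b ^ (n - i) * (?J ^ j * ?L ^ (n - i))) * (b * ?J) ^ d"
    proof -
      have "b ^ (n - j) = b ^ (n - i) * b ^ d" by (metis eqs(2) power_add)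
      then show ?thesis by (simp add: eqs(1) power_add power_mult_distrib)
    qed
    ultimately show "a ^ i * b ^ (n - i) * (?J ^ j * ?L ^ (n - j)) \<le>
        a ^ j * b ^ (n - j) * (?J ^ i * ?L ^ (n - i))" by (simp only:)
  qed simp
  also have "\<dots> \<le> (\<Sum>i\<le>n. real (n choose i) * (a ^ j * b ^ (n - j) * (?J ^ i * ?L ^ (n - i))))"
    using assms by (intro sum_mono2) auto
  also have "\<dots> = a ^ j * b ^ (n - j) * (?J + ?L) ^ n"
    by (simp add: binomial_ring sum_distrib_left mult_ac)
  also have "?J + ?L = real n"
    using \<open>j \<le> n\<close> by simp
  finally show ?thesis .
qed

text \<open>
  With \<open>T j\<close> the binomial tail, the binomial term is \<open>T j - T (Suc j)\<close>, and
  \<open>(u - v) / sqrt u \<le> 2 * (sqrt u - sqrt v)\<close>. So each product of weights above the mean is bounded by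
  an increment of \<open>sqrt T\<close>, and these increments telescope.
\<close>

lemma half_weight_mult_le:
  fixes a b :: real
  assumes "0 \<le> a" "0 \<le> b" "j \<le> n" and above: "a * real (n - j) \<le> b * real j"
  shows "fact n * (half_weight a j * half_weight b (n - j)) \<le>
    2 * sqrt (real n ^ n) * (sqrt (binomial_tail a b n j) - sqrt (binomial_tail a b n (Suc j)))"
proof -
  define q where "q = a ^ j * b ^ (n - j)"
  define r where "r = real j ^ j * real (n - j) ^ (n - j)"
  define c where "c = real (n choose j)"
  define N where "N = real n ^ n"
  define T T' where "T = binomial_tail a b n j" and "T' = binomial_tail a b n (Suc j)"
  have "0 \<le> q" "0 \<le> r" "0 < c" "0 \<le> N"
    using assms by (auto simp: q_def r_def c_def N_def)
  have "0 \<le> T'"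
    using assms by (simp add: T'_def binomial_tail_nonneg)
  have TT': "T = c * q + T'"
    using binomial_tail_Suc[OF \<open>j \<le> n\<close>, of a b] by (simp add: T_def T'_def c_def q_def)
  then have "T' \<le> T" using \<open>0 \<le> q\<close> \<open>0 < c\<close> by simp
  have lhs: "fact n * (half_weight a j * half_weight b (n - j)) = c * (sqrt q * sqrt r)"
    using \<open>j \<le> n\<close>
    by (simp add: half_weight_def c_def q_def r_def binomial_fact real_sqrt_mult real_sqrt_power
        power_mult_distrib)
  have "c * (sqrt q * sqrt r) \<le> 2 * sqrt N * (sqrt T - sqrt T')"
  proof (cases "T = 0")
    case True
    then have "c * q = 0" using TT' \<open>0 \<le> T'\<close> \<open>0 \<le> q\<close> \<open>0 < c\<close>
      by (smt (verit) mult_nonneg_nonneg)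
    then have "q = 0" using \<open>0 < c\<close> by simp
    then show ?thesis using \<open>T' \<le> T\<close> \<open>0 \<le> N\<close> by simp
  next
    case False
    then have "0 < T" using \<open>T' \<le> T\<close> \<open>0 \<le> T'\<close> by simp
    have "T * r \<le> q * N"
      using binomial_tail_le[OF assms] by (simp add: T_def r_def q_def N_def)
    then have "sqrt T * sqrt r \<le> sqrt q * sqrt N"
      by (metis real_sqrt_le_mono real_sqrt_mult)
    then have "c * sqrt q * (sqrt T * sqrt r) \<le> c * sqrt q * (sqrt q * sqrt N)"
      using \<open>0 < c\<close> \<open>0 \<le> q\<close> by (intro mult_left_mono) auto
    also have "\<dots> = sqrt N * (T - T')"
      using \<open>0 \<le> q\<close> by (simp add: TT')
    also have "T - T' = (sqrt T - sqrt T') * (sqrt T + sqrt T')"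
      using \<open>0 < T\<close> \<open>0 \<le> T'\<close> by (simp add: algebra_simps)
    also have "sqrt N * \<dots> \<le> sqrt N * ((sqrt T - sqrt T') * (2 * sqrt T))"
      using \<open>T' \<le> T\<close> \<open>0 \<le> N\<close> by (intro mult_left_mono) auto
    finally have "sqrt T * (c * (sqrt q * sqrt r)) \<le> sqrt T * (2 * sqrt N * (sqrt T - sqrt T'))"
      by (simp add: mult_ac)
    then show ?thesis using \<open>0 < T\<close> by simp
  qed
  then show ?thesis
    by (simp add: lhs N_def T_def T'_def)
qed

lemma half_weight_convolution_above:
  fixes a b :: real
  assumes "0 \<le> a" "0 \<le> b"
  shows "(\<Sum>j | j \<le> n \<and> a * real (n - j) \<le> b * real j. half_weight a j * half_weight b (n - j))
    \<le> 2 * half_weight (a + b) n"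
proof -
  let ?A = "{j. j \<le> n \<and> a * real (n - j) \<le> b * real j}"
  let ?T = "binomial_tail a b n"
  have mono: "sqrt (?T (Suc j)) \<le> sqrt (?T j)" if "j \<le> n" for j
    using assms binomial_tail_Suc[OF that, of a b] by simp
  have "fact n * (\<Sum>j\<in>?A. half_weight a j * half_weight b (n - j)) \<le>
      (\<Sum>j\<in>?A. 2 * sqrt (real n ^ n) * (sqrt (?T j) - sqrt (?T (Suc j))))"
    unfolding sum_distrib_left
    by (intro sum_mono half_weight_mult_le) (use assms in auto)
  also have "\<dots> \<le> (\<Sum>j\<le>n. 2 * sqrt (real n ^ n) * (sqrt (?T j) - sqrt (?T (Suc j))))"
    using mono by (intro sum_mono2) auto
  also have "\<dots> = 2 * sqrt (real n ^ n) * (sqrt (?T 0) - sqrt (?T (Suc n)))"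
    unfolding sum_distrib_left[symmetric] by (simp only: sum_telescope[of "\<lambda>j. sqrt (?T j)"])
  also have "\<dots> = 2 * sqrt (real n ^ n) * sqrt ((a + b) ^ n)"
    by (simp add: binomial_tail_0) (simp add: binomial_tail_def)
  also have "\<dots> = fact n * (2 * half_weight (a + b) n)"
    by (simp add: half_weight_def real_sqrt_mult real_sqrt_power power_mult_distrib)
  finally show ?thesis by simp
qed

lemma half_weight_convolution:
  fixes a b :: real
  assumes "0 \<le> a" "0 \<le> b"
  shows "(\<Sum>j\<le>n. half_weight a j * half_weight b (n - j)) \<le> 4 * half_weight (a + b) n"
proof -
  let ?f = "\<lambda>j. half_weight a j * half_weight b (n - j)"
  let ?A = "{j. j \<le> n \<and> a * real (n - j) \<le> b * real j}"
  let ?B = "{j. j \<le> n \<and> b * real j \<le> a * real (n - j)}"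
  have "(\<Sum>j\<le>n. ?f j) = sum ?f (?A \<union> ?B)"
    by (rule sum.cong) auto
  also have "\<dots> \<le> sum ?f ?A + sum ?f ?B"
    using assms by (subst sum_Un) (auto intro!: sum_nonneg simp: half_weight_nonneg)
  also have "sum ?f ?B =
      (\<Sum>j | j \<le> n \<and> b * real (n - j) \<le> a * real j. half_weight b j * half_weight a (n - j))"
    by (rule sum.reindex_bij_witness[of _ "\<lambda>j. n - j" "\<lambda>j. n - j"]) auto
  also have "\<dots> \<le> 2 * half_weight (a + b) n"
    using half_weight_convolution_above[of b a n] assms by (simp add: add.commute)
  finally show ?thesis
    using half_weight_convolution_above[of a b n] assms by simp
qed

section \<open>Sums over count vectors\<close>

definition count_vectors :: "'a set \<Rightarrow> nat \<Rightarrow> ('a \<Rightarrow> nat) set" where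
  "count_vectors A n = {x. (\<forall>i. i \<notin> A \<longrightarrow> x i = 0) \<and> sum x A = n}"

lemma finite_count_vectors:
  assumes "finite A"
  shows "finite (count_vectors A n)"
proof (rule finite_subset)
  show "count_vectors A n \<subseteq> {x. \<forall>i. (i \<in> A \<longrightarrow> x i \<in> {..n}) \<and> (i \<notin> A \<longrightarrow> x i = 0)}"
    using member_le_sum[OF _ _ assms] by (auto simp: count_vectors_def)
  show "finite {x. \<forall>i. (i \<in> A \<longrightarrow> x i \<in> {..n}) \<and> (i \<notin> A \<longrightarrow> x i = (0::nat))}"
    by (rule finite_set_of_finite_funs) (use assms in auto)
qed

lemma sum_count_vectors_insert:
  fixes g :: "'a \<Rightarrow> nat \<Rightarrow> 'b::comm_semiring_1"
  assumes "finite A" "a \<notin> A"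
  shows "(\<Sum>x\<in>count_vectors (insert a A) n. \<Prod>i\<in>insert a A. g i (x i)) =
    (\<Sum>j\<le>n. g a j * (\<Sum>x\<in>count_vectors A (n - j). \<Prod>i\<in>A. g i (x i)))"
proof -
  have upd: "sum (x(a := j)) A = sum x A" for x :: "'a \<Rightarrow> nat" and j
    using assms by (intro sum.cong) auto
  have "(\<Sum>j\<le>n. g a j * (\<Sum>x\<in>count_vectors A (n - j). \<Prod>i\<in>A. g i (x i))) =
      (\<Sum>(j, x)\<in>(SIGMA j:{..n}. count_vectors A (n - j)). g a j * (\<Prod>i\<in>A. g i (x i)))"
    using assms by (simp add: sum_distrib_left sum.Sigma finite_count_vectors)
  also have "\<dots> = (\<Sum>x\<in>count_vectors (insert a A) n. \<Prod>i\<in>insert a A. g i (x i))"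
  proof (rule sum.reindex_bij_witness[of _ "\<lambda>x. (x a, x(a := 0))" "\<lambda>(j, x). x(a := j)"],
      goal_cases)
    case (1 jx)
    then show ?case using assms by (auto simp: count_vectors_def fun_eq_iff)
  next
    case (2 jx)
    then show ?case using assms upd by (auto simp: count_vectors_def)
  next
    case (3 x)
    then show ?case by auto
  next
    case (4 x)
    then show ?case using assms upd by (auto simp: count_vectors_def)
  next
    case (5 jx)
    have "(\<Prod>i\<in>A. g i ((x(a := j)) i)) = (\<Prod>i\<in>A. g i (x i))" for x and j :: nat
      using assms by (intro prod.cong) auto
    then show ?case using assms by (cases jx) auto
  qed
  finally show ?thesis by simp
qed

lemma sum_prod_half_weight_le:
  fixes p :: "'a \<Rightarrow> real"
  assumes "finite A" "\<And>i. i \<in> A \<Longrightarrow> 0 \<le> p i"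
  shows "(\<Sum>x\<in>count_vectors A n. \<Prod>i\<in>A. half_weight (p i) (x i))
    \<le> 4 ^ card A * half_weight (sum p A) n"
  using assms
proof (induction A arbitrary: n rule: finite_induct)
  case empty
  have "count_vectors {} n = (if n = 0 then {\<lambda>_::'a. 0} else {})"
    by (auto simp: count_vectors_def)
  then show ?case by (simp add: half_weight_def)
next
  case (insert a A)
  have "0 \<le> p a" and "0 \<le> sum p A"
    using insert.prems by (auto intro: sum_nonneg)
  have "(\<Sum>x\<in>count_vectors (insert a A) n. \<Prod>i\<in>insert a A. half_weight (p i) (x i)) =
      (\<Sum>j\<le>n. half_weight (p a) j *
        (\<Sum>x\<in>count_vectors A (n - j). \<Prod>i\<in>A. half_weight (p i) (x i)))"
    by (rule sum_count_vectors_insert) (use insert.hyps in auto)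
  also have "\<dots> \<le> (\<Sum>j\<le>n. half_weight (p a) j * (4 ^ card A * half_weight (sum p A) (n - j)))"
    using insert \<open>0 \<le> p a\<close> by (intro sum_mono mult_left_mono half_weight_nonneg) auto
  also have "\<dots> = 4 ^ card A * (\<Sum>j\<le>n. half_weight (p a) j * half_weight (sum p A) (n - j))"
    by (simp add: sum_distrib_left mult_ac)
  also have "\<dots> \<le> 4 ^ card A * (4 * half_weight (p a + sum p A) n)"
    using \<open>0 \<le> p a\<close> \<open>0 \<le> sum p A\<close> by (intro mult_left_mono half_weight_convolution) auto
  finally show ?case using insert.hyps by (simp add: mult_ac)
qed

section \<open>Exponential moment of the likelihood ratio statistic\<close>

lemma set_multinomial_pmf:
  assumes p: "p \<in> prob_simplex k" and x: "x \<in> set_pmf (multinomial_pmf n k p)"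
  shows "x \<in> count_vectors {1..k} n" and "\<And>i. i \<in> {1..k} \<Longrightarrow> p i = 0 \<Longrightarrow> x i = 0"
proof -
  obtain xs where xs: "x = count_list xs" "length xs = n"
      "set xs \<subseteq> set_pmf (categorical_pmf k p)"
    using x by (auto simp: multinomial_pmf_def set_replicate_pmf)
  have set_xs: "i \<in> {1..k} \<and> p i \<noteq> 0" if "i \<in> set xs" for i
    using xs(3) that by (auto simp: set_pmf_eq pmf_categorical_pmf[OF p] split: if_splits)
  have "sum (count_list xs) {1..k} = sum (count_list xs) (set xs)"
    using set_xs by (intro sum.mono_neutral_right) (auto simp: count_list_0_iff)
  then show "x \<in> count_vectors {1..k} n"
    using set_xs xs by (auto simp: count_vectors_def sum_count_set count_list_0_iff)
  show "x i = 0" if "i \<in> {1..k}" "p i = 0" for i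
    using set_xs xs(1) that by (auto simp: count_list_0_iff)
qed

text \<open>
  Gibbs' inequality, from \<open>ln t \<le> t - 1\<close> in the form \<open>q - p \<le> q ln (q / p)\<close>.
\<close>

lemma Z_stat_nonneg:
  assumes p: "p \<in> prob_simplex k" and "1 \<le> n" and x: "x \<in> set_pmf (multinomial_pmf n k p)"
  shows "0 \<le> Z_stat n k p x"
proof -
  let ?q = "empirical n x"
  note xs = set_multinomial_pmf[OF p x]
  have "?q i - p i \<le> ?q i * ln (?q i / p i)" if i: "i \<in> {1..k}" for i
  proof (cases "x i = 0")
    case True
    then show ?thesis using p i by (simp add: empirical_def prob_simplex_def)
  next
    case False
    then have "0 < p i" and "0 < ?q i"
      using xs(2)[OF i] p i \<open>1 \<le> n\<close> by (force simp: empirical_def prob_simplex_def)+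
    then have "ln (p i / ?q i) \<le> p i / ?q i - 1"
      by (intro ln_le_minus_one) simp
    then have "?q i * ln (p i / ?q i) \<le> ?q i * (p i / ?q i - 1)"
      using \<open>0 < ?q i\<close> by (intro mult_left_mono) auto
    then show ?thesis
      using \<open>0 < p i\<close> \<open>0 < ?q i\<close> by (simp add: ln_div algebra_simps)
  qed
  then have "(\<Sum>i=1..k. ?q i - p i) \<le> rel_entropy k ?q p"
    unfolding rel_entropy_def by (intro sum_mono)
  moreover have "(\<Sum>i=1..k. ?q i) = 1"
  proof -
    have "(\<Sum>i=1..k. real (x i)) = real n"
      using xs(1) by (simp add: count_vectors_def flip: of_nat_sum)
    then show ?thesis
      using \<open>1 \<le> n\<close> by (simp add: empirical_def flip: sum_divide_distrib)
  qed
  ultimately have "0 \<le> rel_entropy k ?q p"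
    using p by (simp add: prob_simplex_def sum_subtractf)
  then show ?thesis by (simp add: Z_stat_def)
qed

lemma power_exp_half_log_ratio:
  fixes p :: real
  assumes "0 \<le> p" "1 \<le> n" "p = 0 \<Longrightarrow> j = 0"
  shows "p ^ j * exp (real j * ln (real j / real n / p) / 2) * sqrt (real n) ^ j =
    sqrt (p * real j) ^ j"
proof (cases "j = 0")
  case False
  then have "0 < p" using assms by force
  define r where "r = real j / real n / p"
  have "0 < r" using False \<open>0 < p\<close> \<open>1 \<le> n\<close> by (simp add: r_def)
  have "exp (real j * ln r / 2) = exp (real j * ln (sqrt r))"
    using \<open>0 < r\<close> by (simp add: ln_sqrt)
  also have "\<dots> = sqrt r ^ j"
    using \<open>0 < r\<close> by (simp add: exp_of_nat_mult)
  finally have e: "exp (real j * ln r / 2) = sqrt r ^ j" .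
  have "p * sqrt r * sqrt (real n) = sqrt p * sqrt (p * r * real n)"
    using \<open>0 < p\<close> by (simp add: real_sqrt_mult)
  also have "p * r * real n = real j"
    using \<open>0 < p\<close> \<open>1 \<le> n\<close> by (simp add: r_def)
  finally have "p * sqrt r * sqrt (real n) = sqrt (p * real j)"
    by (simp add: real_sqrt_mult)
  then show ?thesis
    unfolding r_def[symmetric] e by (metis power_mult_distrib)
qed simp

text \<open>
  The statistic is a sum over the coordinates, so the tilted probability is again a product. The
  restriction to the support excludes \<open>x i > 0 = p i\<close>, where the logarithm has a default value.
\<close>

lemma pmf_multinomial_exp_Z_stat:
  assumes p: "p \<in> prob_simplex k" and "1 \<le> n" and x: "x \<in> set_pmf (multinomial_pmf n k p)"
  shows "pmf (multinomial_pmf n k p) x * exp (Z_stat n k p x / 4) * half_weight 1 n =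
    (\<Prod>i=1..k. half_weight (p i) (x i))"
proof -
  note xs = set_multinomial_pmf[OF p x]
  have sum: "(\<Sum>i=1..k. x i) = n" and zero: "\<And>i. i \<notin> {1..k} \<Longrightarrow> x i = 0"
    using xs(1) by (auto simp: count_vectors_def)
  have pmf: "pmf (multinomial_pmf n k p) x =
      fact n / (\<Prod>i=1..k. fact (x i)) * (\<Prod>i=1..k. p i ^ x i)"
    using p sum zero by (rule pmf_multinomial_pmf)
  let ?e = "\<lambda>i. exp (real (x i) * ln (real (x i) / real n / p i) / 2)"
  have "Z_stat n k p x / 4 = (\<Sum>i=1..k. real (x i) * ln (real (x i) / real n / p i) / 2)"
    using \<open>1 \<le> n\<close>
    by (simp add: Z_stat_def rel_entropy_def empirical_def sum_distrib_left sum_divide_distrib)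
  then have e: "exp (Z_stat n k p x / 4) = (\<Prod>i=1..k. ?e i)"
    by (simp add: exp_sum)
  have "(\<Prod>i=1..k. sqrt (real n) ^ x i) = sqrt (real n) ^ n"
    by (simp only: power_sum[symmetric] sum)
  then have w: "half_weight 1 n = (\<Prod>i=1..k. sqrt (real n) ^ x i) / fact n"
    by (simp add: half_weight_def)
  have "pmf (multinomial_pmf n k p) x * exp (Z_stat n k p x / 4) * half_weight 1 n =
      (\<Prod>i=1..k. p i ^ x i * ?e i * sqrt (real n) ^ x i) / (\<Prod>i=1..k. fact (x i))"
    unfolding pmf e w by (simp add: prod.distrib)
  also have "(\<Prod>i=1..k. p i ^ x i * ?e i * sqrt (real n) ^ x i) =
      (\<Prod>i=1..k. sqrt (p i * real (x i)) ^ x i)"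
    using p xs(2) \<open>1 \<le> n\<close>
    by (intro prod.cong power_exp_half_log_ratio) (auto simp: prob_simplex_def)
  finally show ?thesis
    by (simp add: half_weight_def prod_dividef)
qed

lemma exp_moment_Z_stat_le:
  assumes p: "p \<in> prob_simplex k" and "1 \<le> n"
  shows "(\<Sum>x\<in>set_pmf (multinomial_pmf n k p).
    pmf (multinomial_pmf n k p) x * exp (Z_stat n k p x / 4)) \<le> 4 ^ k"
proof -
  let ?M = "multinomial_pmf n k p"
  have pos: "0 < half_weight 1 n"
    using \<open>1 \<le> n\<close> by (simp add: half_weight_def)
  have "(\<Sum>x\<in>set_pmf ?M. pmf ?M x * exp (Z_stat n k p x / 4)) * half_weight 1 n =
      (\<Sum>x\<in>set_pmf ?M. \<Prod>i=1..k. half_weight (p i) (x i))"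
    by (simp add: sum_distrib_right pmf_multinomial_exp_Z_stat[OF assms])
  also have "\<dots> \<le> (\<Sum>x\<in>count_vectors {1..k} n. \<Prod>i=1..k. half_weight (p i) (x i))"
    using p set_multinomial_pmf(1)[OF p]
    by (intro sum_mono2 finite_count_vectors)
      (auto intro!: prod_nonneg half_weight_nonneg simp: prob_simplex_def)
  also have "\<dots> \<le> 4 ^ card {1..k} * half_weight (sum p {1..k}) n"
    using p by (intro sum_prod_half_weight_le) (auto simp: prob_simplex_def)
  also have "\<dots> = 4 ^ k * half_weight 1 n"
    using p by (simp add: prob_simplex_def)
  finally show ?thesis using pos by simp
qed

section \<open>From the exponential moment to all moments\<close>

text \<open>
  Subtracting \<open>c\<close> in the exponent is what makes the resulting moment bound linear in \<open>c + m\<close>: an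
  exponential moment of order \<open>exp c\<close> is absorbed without a factor that grows with \<open>c\<close>.
\<close>

lemma power_le_exp_excess:
  fixes y c :: real
  assumes "0 \<le> y" "0 \<le> c" "1 \<le> m"
  shows "y ^ m \<le> (c + real m) ^ m * (1 + exp (y - c))"
proof (cases "y \<le> c")
  case True
  then have "y ^ m \<le> (c + real m) ^ m"
    using assms by (intro power_mono) auto
  also have "\<dots> \<le> (c + real m) ^ m * (1 + exp (y - c))"
    using assms by (intro mult_le_cancel_left1[THEN iffD2]) (auto simp: not_less)
  finally show ?thesis .
next
  case False
  have "1 * (y - c) \<le> (c + real m) / real m * (y - c)"
    using False assms by (intro mult_right_mono) auto
  then have "y \<le> (c + real m) + (c + real m) / real m * (y - c)"
    by simp
  also have "\<dots> = (c + real m) * (1 + (y - c) / real m)"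
    by (simp add: distrib_left)
  also have "\<dots> \<le> (c + real m) * exp ((y - c) / real m)"
    using assms by (intro mult_left_mono exp_ge_add_one_self) auto
  finally have "y ^ m \<le> ((c + real m) * exp ((y - c) / real m)) ^ m"
    using assms by (intro power_mono) auto
  also have "\<dots> = (c + real m) ^ m * exp (y - c)"
    using assms by (simp add: power_mult_distrib flip: exp_of_nat_mult)
  also have "\<dots> \<le> (c + real m) ^ m * (1 + exp (y - c))"
    using assms by (intro mult_left_mono) auto
  finally show ?thesis .
qed

lemma moment_Z_stat_le:
  assumes p: "p \<in> prob_simplex k" and "1 \<le> n" "1 \<le> m"
  shows "(\<integral>x. \<bar>Z_stat n k p x\<bar> ^ m \<partial>measure_pmf (multinomial_pmf n k p)) \<le> (16 * real (k + m)) ^ m"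
proof -
  let ?M = "multinomial_pmf n k p" and ?Z = "Z_stat n k p"
  \<comment> \<open>The level \<open>c\<close> is chosen so that \<open>exp c\<close> dominates the exponential moment \<open>4 ^ k\<close>.\<close>
  define c where "c = 2 * real k"
  define B where "B = 4 ^ m * (c + real m) ^ m"
  have "0 \<le> B" by (simp add: B_def c_def)
  have fin: "finite (set_pmf ?M)"
    by (rule finite_set_multinomial_pmf[OF p])
  have point: "\<bar>?Z x\<bar> ^ m \<le> B * (1 + exp (- c) * exp (?Z x / 4))" if "x \<in> set_pmf ?M" for x
  proof -
    have "0 \<le> ?Z x" using Z_stat_nonneg[OF p \<open>1 \<le> n\<close> that] .
    then have "\<bar>?Z x\<bar> ^ m = 4 ^ m * (?Z x / 4) ^ m"
      by (simp add: power_divide)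
    also have "\<dots> \<le> 4 ^ m * ((c + real m) ^ m * (1 + exp (?Z x / 4 - c)))"
      using \<open>0 \<le> ?Z x\<close> \<open>1 \<le> m\<close> by (intro mult_left_mono power_le_exp_excess) (auto simp: c_def)
    also have "exp (?Z x / 4 - c) = exp (- c) * exp (?Z x / 4)"
      by (simp flip: exp_add)
    finally show ?thesis
      by (simp only: B_def mult.assoc)
  qed
  have "(\<integral>x. \<bar>?Z x\<bar> ^ m \<partial>measure_pmf ?M) = (\<Sum>x\<in>set_pmf ?M. pmf ?M x * \<bar>?Z x\<bar> ^ m)"
    by (subst integral_measure_pmf[OF fin]) auto
  also have "\<dots> \<le> (\<Sum>x\<in>set_pmf ?M. pmf ?M x * (B * (1 + exp (- c) * exp (?Z x / 4))))"
    by (intro sum_mono mult_left_mono point) auto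
  also have "\<dots> = B * (\<Sum>x\<in>set_pmf ?M. pmf ?M x) +
      B * exp (- c) * (\<Sum>x\<in>set_pmf ?M. pmf ?M x * exp (?Z x / 4))"
    by (simp add: sum_distrib_left sum.distrib algebra_simps)
  also have "(\<Sum>x\<in>set_pmf ?M. pmf ?M x) = 1"
    by (rule sum_pmf_eq_1) (use fin in auto)
  also have "B * exp (- c) * (\<Sum>x\<in>set_pmf ?M. pmf ?M x * exp (?Z x / 4)) \<le> B * exp (- c) * exp c"
  proof -
    have "(4::real) ^ k \<le> exp 2 ^ k"
    proof (rule power_mono)
      have "(2::real) * 2 \<le> exp 1 * exp 1"
        using exp_ge_add_one_self[of 1] by (intro mult_mono) auto
      then show "(4::real) \<le> exp 2" by (simp flip: exp_add)
    qed simp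
    also have "\<dots> = exp c"
      by (simp add: c_def mult.commute flip: exp_of_nat_mult)
    finally show ?thesis
      using exp_moment_Z_stat_le[OF p \<open>1 \<le> n\<close>] \<open>0 \<le> B\<close> by (intro mult_left_mono) auto
  qed
  also have "B * 1 + B * exp (- c) * exp c = 2 * B"
    by (simp add: exp_minus)
  also have "\<dots> \<le> 2 ^ m * B"
    using \<open>0 \<le> B\<close> self_le_power[of "2::real" m] \<open>1 \<le> m\<close> by (intro mult_right_mono) auto
  also have "\<dots> = (8 * (c + real m)) ^ m"
    by (simp add: B_def power_mult_distrib flip: mult.assoc)
      (simp flip: power_mult_distrib)
  also have "\<dots> \<le> (16 * real (k + m)) ^ m"
    by (intro power_mono) (auto simp: c_def)
  finally show ?thesis by simp
qed

theorem proposition1: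
  shows "\<exists>K::real. 0 < K \<and>
    (\<forall>k n m. \<forall>p \<in> prob_simplex k. 2 \<le> k \<longrightarrow> 1 \<le> n \<longrightarrow> 1 \<le> m \<longrightarrow>
      moment_norm (measure_pmf (multinomial_pmf n k p)) m (Z_stat n k p) \<le> K * real (k + m))"
proof (intro exI[of _ 16] conjI allI ballI impI)
  fix k n m :: nat and p
  assume p: "p \<in> prob_simplex k" and "1 \<le> n" "1 \<le> m"
  have "moment_norm (measure_pmf (multinomial_pmf n k p)) m (Z_stat n k p) \<le>
      root m ((16 * real (k + m)) ^ m)"
    unfolding moment_norm_def
    using moment_Z_stat_le[OF p \<open>1 \<le> n\<close> \<open>1 \<le> m\<close>] \<open>1 \<le> m\<close> by (intro real_root_le_mono) auto
  also have "\<dots> = 16 * real (k + m)"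
    using \<open>1 \<le> m\<close> by (intro real_root_power_cancel) auto
  finally show "moment_norm (measure_pmf (multinomial_pmf n k p)) m (Z_stat n k p) \<le>
      16 * real (k + m)" .
qed simp

end
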